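(* Let $a,b,c\in\mathbb C$ and $d\in\mathbb N$ be such that the $\Re$-module $R_d(a,b,c)$ is irreducible. Then the following are equivalent: (i) $A,B,C$ act on $R_d(a,b,c)$ as a Leonard triple; (ii) $A,B,C$ are each diagonalizable on $R_d(a,b,c)$; (iii) none of $a,b,c$ belongs to $\{\frac{i-d-1}{2}\mid i=1,2,\dots,2d-1\}$.
   Context: $\Re$ is the unital associative $\mathbb C$-algebra generated by $A,B,C,\Delta$ with $[A,B]=[B,C]=[C,A]=2\Delta$ and such that $\alpha=[A,\Delta]+AC-BA$, $\beta=[B,\Delta]+BA-CB$, $\gamma=[C,\Delta]+CB-AC$ are central; $\delta=A+B+C$. For $a,b,c\in\mathbb C$, $d\in\mathbb N$, $R_d(a,b,c)$ denotes the $(d+1)$-dimensional $\Re$-module (known to exist, determined up to isomorphism by these data) having a basis with respect to which $A$ is the lower bidiagonal matrix with diagonal $\theta_i=(a+\frac d2-i)(a+\frac d2-i+1)$ ($0\le i\le d$) and subdiagonal entries $1$; $B$ is the upper bidiagonal matrix with diagonal $\theta^*_i=(b+\frac d2-i)(b+\frac d2-i+1)$ and superdiagonal $\varphi_i=i(i-d-1)(a+b+c+\frac d2-i+2)(a+b-c+\frac d2-i+1)$ ($1\le i\le d$); and $\alpha,\beta,\gamma,\delta$ act as the scalars $(c-b)(c+b+1)(a-\frac d2)(a+\frac d2+1)$, $(a-c)(a+c+1)(b-\frac d2)(b+\frac d2+1)$, $(b-a)(b+a+1)(c-\frac d2)(c+\frac d2+1)$, $\frac d2(\frac d2+1)+a(a+1)+b(b+1)+c(c+1)$.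 A square matrix is tridiagonal if every nonzero entry lies on the diagonal, subdiagonal or superdiagonal, and irreducible tridiagonal if moreover all sub- and superdiagonal entries are nonzero. An ordered triple $L,L^*,L^\varepsilon$ of linear operators on a finite-dimensional nonzero space $V$ is a Leonard triple if for each of the three operators there is a basis of $V$ in which that operator is diagonal and the other two are irreducible tridiagonal. *)

theory Defs
  imports "Jordan_Normal_Form.Matrix"
begin

text \<open>The module R_d(a,b,c) on C^(d+1), given by the matrices of A, B, C, Delta
  in the distinguished basis. Indices run over 0..d (rows/columns 0..d).\<close>

definition theta :: "complex \<Rightarrow> nat \<Rightarrow> nat \<Rightarrow> complex" where
  "theta a d i = (a + of_nat d / 2 - of_nat i) * (a + of_nat d / 2 - of_nat i + 1)"

definition phi :: "complex \<Rightarrow> complex \<Rightarrow> complex \<Rightarrow> nat \<Rightarrow> nat \<Rightarrow> complex" where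
  "phi a b c d i = of_nat i * (of_nat i - of_nat d - 1)
      * (a + b + c + of_nat d / 2 - of_nat i + 2) * (a + b - c + of_nat d / 2 - of_nat i + 1)"

definition deltaR :: "complex \<Rightarrow> complex \<Rightarrow> complex \<Rightarrow> nat \<Rightarrow> complex" where
  "deltaR a b c d = (of_nat d / 2) * (of_nat d / 2 + 1) + a * (a + 1) + b * (b + 1) + c * (c + 1)"

definition RA :: "complex \<Rightarrow> complex \<Rightarrow> complex \<Rightarrow> nat \<Rightarrow> complex mat" where
  "RA a b c d = mat (d+1) (d+1) (\<lambda>(i,j). if i = j then theta a d i else if i = j + 1 then 1 else 0)"

definition RB :: "complex \<Rightarrow> complex \<Rightarrow> complex \<Rightarrow> nat \<Rightarrow> complex mat" where
  "RB a b c d = mat (d+1) (d+1) (\<lambda>(i,j). if i = j then theta b d i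
       else if j = i + 1 then phi a b c d j else 0)"

text \<open>delta = A + B + C acts as the scalar deltaR, so C acts as deltaR I - A - B.\<close>
definition RC :: "complex \<Rightarrow> complex \<Rightarrow> complex \<Rightarrow> nat \<Rightarrow> complex mat" where
  "RC a b c d = deltaR a b c d \<cdot>\<^sub>m 1\<^sub>m (d+1) - RA a b c d - RB a b c d"

definition RDelta :: "complex \<Rightarrow> complex \<Rightarrow> complex \<Rightarrow> nat \<Rightarrow> complex mat" where
  "RDelta a b c d = (1/2 :: complex) \<cdot>\<^sub>m (RA a b c d * RB a b c d - RB a b c d * RA a b c d)"

definition is_subspace :: "nat \<Rightarrow> complex vec set \<Rightarrow> bool" where
  "is_subspace n W \<longleftrightarrow> W \<subseteq> carrier_vec n \<and> 0\<^sub>v n \<in> W \<and>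
     (\<forall>u\<in>W. \<forall>v\<in>W. u + v \<in> W) \<and> (\<forall>k. \<forall>u\<in>W. k \<cdot>\<^sub>v u \<in> W)"

definition invariant_under :: "complex mat \<Rightarrow> complex vec set \<Rightarrow> bool" where
  "invariant_under M W \<longleftrightarrow> (\<forall>v\<in>W. M *\<^sub>v v \<in> W)"

definition R_irreducible :: "complex \<Rightarrow> complex \<Rightarrow> complex \<Rightarrow> nat \<Rightarrow> bool" where
  "R_irreducible a b c d \<longleftrightarrow>
     (\<forall>W. is_subspace (d+1) W \<and> invariant_under (RA a b c d) W \<and> invariant_under (RB a b c d) W
        \<and> invariant_under (RC a b c d) W \<and> invariant_under (RDelta a b c d) W
        \<longrightarrow> W = {0\<^sub>v (d+1)} \<or> W = carrier_vec (d+1))"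

definition tridiagonal :: "complex mat \<Rightarrow> bool" where
  "tridiagonal M \<longleftrightarrow> (\<forall>i<dim_row M. \<forall>j<dim_col M. M $$ (i,j) \<noteq> 0 \<longrightarrow> i \<le> j + 1 \<and> j \<le> i + 1)"

definition irred_tridiagonal :: "complex mat \<Rightarrow> bool" where
  "irred_tridiagonal M \<longleftrightarrow> tridiagonal M \<and>
     (\<forall>i. i + 1 < dim_row M \<longrightarrow> M $$ (i+1, i) \<noteq> 0 \<and> M $$ (i, i+1) \<noteq> 0)"

text \<open>Change of basis: columns of P form the new basis, Q = P^{-1};
  the matrix of the operator M in the new basis is Q * M * P.\<close>
definition basis_change :: "nat \<Rightarrow> complex mat \<Rightarrow> complex mat \<Rightarrow> bool" where
  "basis_change n P Q \<longleftrightarrow> P \<in> carrier_mat n n \<and> Q \<in> carrier_mat n n \<and> P * Q = 1\<^sub>m n \<and> Q * P = 1\<^sub>m n"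

definition diagonalizable :: "nat \<Rightarrow> complex mat \<Rightarrow> bool" where
  "diagonalizable n M \<longleftrightarrow> (\<exists>P Q. basis_change n P Q \<and> diagonal_mat (Q * M * P))"

definition leonard_triple :: "nat \<Rightarrow> complex mat \<Rightarrow> complex mat \<Rightarrow> complex mat \<Rightarrow> bool" where
  "leonard_triple n L1 L2 L3 \<longleftrightarrow> 0 < n \<and>
     (\<exists>P Q. basis_change n P Q \<and> diagonal_mat (Q * L1 * P)
        \<and> irred_tridiagonal (Q * L2 * P) \<and> irred_tridiagonal (Q * L3 * P)) \<and>
     (\<exists>P Q. basis_change n P Q \<and> diagonal_mat (Q * L2 * P)
        \<and> irred_tridiagonal (Q * L1 * P) \<and> irred_tridiagonal (Q * L3 * P)) \<and>
     (\<exists>P Q. basis_change n P Q \<and> diagonal_mat (Q * L3 * P)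
        \<and> irred_tridiagonal (Q * L1 * P) \<and> irred_tridiagonal (Q * L2 * P))"

definition bad_values :: "nat \<Rightarrow> complex set" where
  "bad_values d = {(of_nat i - of_nat d - 1) / 2 | i::nat. 1 \<le> i \<and> i + 1 \<le> 2 * d}"

end

theory Submission
  imports Defs "Jordan_Normal_Form.Determinant"
begin

text \<open>In the distinguished basis A is lower bidiagonal with nonzero subdiagonal, so its eigenspaces
  are lines, and A is diagonalizable iff the \<^term>\<open>theta a d i\<close> are pairwise distinct, i.e. iff
  a is not a bad value. Irreducibility forces \<^term>\<open>phi a b c d i \<noteq> 0\<close>, so reversing and
  rescaling the basis brings B to the same shape, with parameter -b-1. For C one uses the chain
  w_0 = e_0, w_(i+1) = (C - theta c d i) w_i; its coefficients are
  (-1)^i (i choose k) prod_(k < h <= i) (d-h+1)(a+b+c+d/2+2-h), whence w_(d+1) = 0.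

  Each ordered pair (X,Y) among (A,B), (B,A), (C,A) satisfies
  [X,[X,Y]] = 2(XY+YX) + 2X^2 - 2 delta X + const. In an eigenbasis of X the (i,j) entry of Y is
  therefore annihilated by (t_i-t_j)^2 - 2(t_i+t_j), which for good parameters vanishes off the
  diagonal only if |i-j| = 1. So Y is tridiagonal, and a vanishing sub- or superdiagonal entry
  would produce an invariant subspace.\<close>

text \<open>The matrices extended to infinite sequences. As \<^term>\<open>phi a b c d (Suc d) = 0\<close>, truncating
  to the indices 0..d intertwines these operators with the matrices, so matrix identities can be
  verified without a boundary case at d.\<close>

definition seqA :: "complex \<Rightarrow> nat \<Rightarrow> (nat \<Rightarrow> complex) \<Rightarrow> nat \<Rightarrow> complex" where
  "seqA a d f i = theta a d i * f i + (case i of 0 \<Rightarrow> 0 | Suc j \<Rightarrow> f j)"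

definition seqB :: "complex \<Rightarrow> complex \<Rightarrow> complex \<Rightarrow> nat \<Rightarrow> (nat \<Rightarrow> complex) \<Rightarrow> nat \<Rightarrow> complex" where
  "seqB a b c d f i = theta b d i * f i + phi a b c d (Suc i) * f (Suc i)"

definition seqC :: "complex \<Rightarrow> complex \<Rightarrow> complex \<Rightarrow> nat \<Rightarrow> (nat \<Rightarrow> complex) \<Rightarrow> nat \<Rightarrow> complex" where
  "seqC a b c d f i = deltaR a b c d * f i - seqA a d f i - seqB a b c d f i"

lemma R_carrier [simp]:
  "RA a b c d \<in> carrier_mat (d+1) (d+1)" "RB a b c d \<in> carrier_mat (d+1) (d+1)"
  "RC a b c d \<in> carrier_mat (d+1) (d+1)"
  by (auto simp: RA_def RB_def RC_def)

lemma R_carrier_Suc [simp]: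
  "RA a b c d \<in> carrier_mat (Suc d) (Suc d)" "RB a b c d \<in> carrier_mat (Suc d) (Suc d)"
  "RC a b c d \<in> carrier_mat (Suc d) (Suc d)"
  using R_carrier[of a b c d] by simp_all

lemma R_dims [simp]:
  "dim_row (RA a b c d) = d+1" "dim_row (RB a b c d) = d+1" "dim_row (RC a b c d) = d+1"
  "dim_col (RA a b c d) = d+1" "dim_col (RB a b c d) = d+1" "dim_col (RC a b c d) = d+1"
  by (auto simp: RA_def RB_def RC_def)

lemma phi_Suc_d: "phi a b c d (Suc d) = 0"
  by (simp add: phi_def)

lemma RA_mult_vec: "RA a b c d *\<^sub>v vec (d+1) f = vec (d+1) (seqA a d f)"
proof (rule eq_vecI, goal_cases)
  case (1 i)
  then have i: "i < d + 1" by simp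
  have "(RA a b c d *\<^sub>v vec (d+1) f) $ i
      = (\<Sum>j\<in>{0..<d+1}. (if j = i then theta a d i * f i else 0) + (if i = j + 1 then f j else 0))"
    using i by (auto simp: RA_def scalar_prod_def intro!: sum.cong)
  also have "\<dots> = theta a d i * f i + (\<Sum>j\<in>{0..<d+1}. if i = j + 1 then f j else 0)"
    using i by (simp add: sum.distrib)
  also have "(\<Sum>j\<in>{0..<d+1}. if i = j + 1 then f j else 0) = (case i of 0 \<Rightarrow> 0 | Suc j \<Rightarrow> f j)"
    using i by (cases i) auto
  finally show ?case using i by (simp add: seqA_def)
qed simp

lemma RB_mult_vec: "RB a b c d *\<^sub>v vec (d+1) f = vec (d+1) (seqB a b c d f)"
proof (rule eq_vecI, goal_cases)
  case (1 i)
  then have i: "i < d + 1" by simp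
  have "(RB a b c d *\<^sub>v vec (d+1) f) $ i
      = (\<Sum>j\<in>{0..<d+1}. (if j = i then theta b d i * f i else 0)
           + (if j = Suc i then phi a b c d (Suc i) * f (Suc i) else 0))"
    using i by (auto simp: RB_def scalar_prod_def intro!: sum.cong)
  also have "\<dots> = theta b d i * f i + (if Suc i < d + 1 then phi a b c d (Suc i) * f (Suc i) else 0)"
    using i by (simp add: sum.distrib)
  also have "\<dots> = seqB a b c d f i"
    using i by (auto simp: seqB_def not_less less_Suc_eq phi_Suc_d)
  finally show ?case using i by simp
qed simp

lemma RC_mult_vec: "RC a b c d *\<^sub>v vec (d+1) f = vec (d+1) (seqC a b c d f)"
proof -
  have v: "vec (d+1) f \<in> carrier_vec (d+1)" by simp
  have "RC a b c d *\<^sub>v vec (d+1) f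
      = deltaR a b c d \<cdot>\<^sub>v vec (d+1) f - RA a b c d *\<^sub>v vec (d+1) f - RB a b c d *\<^sub>v vec (d+1) f"
    unfolding RC_def
    by (subst minus_mult_distrib_mat_vec[where nr = "d+1" and nc = "d+1"],
        force, force, force,
        subst minus_mult_distrib_mat_vec[where nr = "d+1" and nc = "d+1"],
        force, force, force, auto)
  also have "\<dots> = vec (d+1) (seqC a b c d f)"
    unfolding RA_mult_vec RB_mult_vec by (auto simp: seqC_def)
  finally show ?thesis .
qed

text \<open>The scalar alpha of the paper; \<^term>\<open>alphaR b a c d\<close> is the paper's -beta.\<close>

definition alphaR :: "complex \<Rightarrow> complex \<Rightarrow> complex \<Rightarrow> nat \<Rightarrow> complex" where
  "alphaR a b c d = (c - b) * (c + b + 1) * (a - of_nat d / 2) * (a + of_nat d / 2 + 1)"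

section \<open>Scalar identities and the cubic relations among A, B and C\<close>

text \<open>Naming \<open>d / 2\<close>, \<open>d\<close> and \<open>i\<close> by variables with
  \<open>d = 2 * D\<close> removes casts and the division, so the later identities become polynomial
  ones. Where \<open>d\<close> also occurs alone, \<open>v(1)\<close> is rewritten first; otherwise
  \<open>d / 2\<close> would turn into \<open>2 * D / 2\<close>.\<close>

lemma half_nat_obtain:
  obtains D m :: complex where "of_nat d / 2 = D" "of_nat d = 2 * D" "of_nat i = m"
  by (metis nonzero_eq_divide_eq mult.commute zero_neq_numeral)

lemma theta_Suc_diff: "theta x d i - theta x d (Suc i) = 2 * (x + of_nat d / 2 - of_nat i)"
proof -
  obtain D m :: complex where v: "of_nat d / 2 = D" "of_nat d = 2 * D" "of_nat i = m"
    by (rule half_nat_obtain)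
  show ?thesis unfolding theta_def of_nat_Suc v(1) v(3) by Groebner_Basis.algebra
qed

text \<open>Consecutive eigenvalues are roots of the polynomial from the overview. This kills the
  band of the relation for (X,Y) in which Y contributes its off-diagonal entry and X only diagonal
  ones.\<close>

lemma theta_Suc_square:
  "(theta x d i - theta x d (Suc i))^2 = 2 * (theta x d i + theta x d (Suc i))"
proof -
  obtain D m :: complex where v: "of_nat d / 2 = D" "of_nat d = 2 * D" "of_nat i = m"
    by (rule half_nat_obtain)
  show ?thesis unfolding theta_def of_nat_Suc v(1) v(3) by Groebner_Basis.algebra
qed

lemma theta_second_diff: "theta x d i - 2 * theta x d (Suc i) + theta x d (Suc (Suc i)) = 2"
  using theta_Suc_diff[of x d i] theta_Suc_diff[of x d "Suc i"]
  unfolding of_nat_Suc by Groebner_Basis.algebra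

lemma phi_swap: "phi b a c d i = phi a b c d i"
  by (simp add: phi_def add.commute)

lemma deltaR_swap: "deltaR b a c d = deltaR a b c d"
  by (simp add: deltaR_def)

text \<open>This is the subdiagonal band of the relation for (A,B): the second difference comes from
  \<open>A^2 B - 2 A B A + B A^2\<close>. Multiplied by the middle \<open>phi\<close>, it is also
  the superdiagonal band of the relation for (B,A).\<close>

lemma phi_second_diff:
  "phi a b c d i - 2 * phi a b c d (Suc i) + phi a b c d (Suc (Suc i))
     = 2 * (theta a d i + theta a d (Suc i)) + 2 * (theta b d i + theta b d (Suc i))
       + (theta a d i - theta a d (Suc i)) * (theta b d i - theta b d (Suc i)) - 2 * deltaR a b c d"
proof -
  obtain D m :: complex where v: "of_nat d / 2 = D" "of_nat d = 2 * D" "of_nat i = m"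
    by (rule half_nat_obtain)
  show ?thesis unfolding theta_def phi_def deltaR_def of_nat_Suc v(1) unfolding v by Groebner_Basis.algebra
qed

text \<open>The diagonal band of the relation for (A,B), where the constant \<open>alphaR\<close>
  enters. Row 0 stands apart because it has no preceding index.\<close>

lemma phi_theta_diagonal_0:
  "phi a b c d (Suc 0) * (theta a d (Suc 0) - theta a d 0 - 2)
   = 4 * theta a d 0 * theta b d 0 + 2 * theta a d 0 ^ 2 - 2 * deltaR a b c d * theta a d 0
     + 2 * alphaR a b c d"
proof -
  obtain D m :: complex where v: "of_nat d / 2 = D" "of_nat d = 2 * D" "of_nat 0 = m"
    by (rule half_nat_obtain)
  show ?thesis
    unfolding theta_def phi_def deltaR_def alphaR_def of_nat_Suc of_nat_0 v(1)
    unfolding v by Groebner_Basis.algebra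
qed

lemma phi_theta_diagonal_Suc:
  "phi a b c d (Suc i) * (theta a d i - theta a d (Suc i) - 2)
     + phi a b c d (Suc (Suc i)) * (theta a d (Suc (Suc i)) - theta a d (Suc i) - 2)
   = 4 * theta a d (Suc i) * theta b d (Suc i) + 2 * theta a d (Suc i) ^ 2
     - 2 * deltaR a b c d * theta a d (Suc i) + 2 * alphaR a b c d"
proof -
  obtain D m :: complex where v: "of_nat d / 2 = D" "of_nat d = 2 * D" "of_nat i = m"
    by (rule half_nat_obtain)
  show ?thesis
    unfolding theta_def phi_def deltaR_def alphaR_def of_nat_Suc v(1)
    unfolding v by Groebner_Basis.algebra
qed

text \<open>Both sides are compared as linear forms in the values of \<open>f\<close>. The
  superdiagonal vanishes by \<open>theta_Suc_square\<close>, the diagonal and subdiagonal are the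
  two \<open>phi\<close> identities, and the second subdiagonal is \<open>theta_second_diff\<close>
  for b. Rows 0 and 1 lack some of these bands.\<close>

lemma seqA_seqB_relation:
  "seqA a d (seqA a d (seqB a b c d f)) i - 2 * seqA a d (seqB a b c d (seqA a d f)) i
     + seqB a b c d (seqA a d (seqA a d f)) i
     - 2 * (seqA a d (seqB a b c d f) i + seqB a b c d (seqA a d f) i)
   = 2 * seqA a d (seqA a d f) i - 2 * deltaR a b c d * seqA a d f i + 2 * alphaR a b c d * f i"
proof -
  consider "i = 0" | "i = Suc 0" | j where "i = Suc (Suc j)"
    by (metis old.nat.exhaust)
  then show ?thesis
  proof cases
    case 1
    show ?thesis
      using theta_Suc_square[of a d 0] phi_theta_diagonal_0[of a b c d]
      unfolding 1 seqA_def seqB_def nat.case by Groebner_Basis.algebra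
  next
    case 2
    \<comment> \<open>The vanishing \<open>phi\<close> at index 0 stands for the absent entry of B
      left of column 0, so the general second difference also covers this row.\<close>
    have "phi a b c d 0 = 0" by (simp add: phi_def)
    then show ?thesis
      using theta_Suc_square[of a d "Suc 0"] phi_theta_diagonal_Suc[of a b c d 0]
        phi_second_diff[of a b c d 0]
      unfolding 2 seqA_def seqB_def nat.case by Groebner_Basis.algebra
  next
    case 3
    show ?thesis
      using theta_Suc_square[of a d "Suc (Suc j)"] phi_theta_diagonal_Suc[of a b c d "Suc j"]
        phi_second_diff[of a b c d "Suc j"] theta_second_diff[of b d j]
      unfolding 3 seqA_def seqB_def nat.case by Groebner_Basis.algebra
  qed
qed

text \<open>The same bands with the triangles exchanged: now the subdiagonal vanishes by
  \<open>theta_Suc_square\<close> for b, and the two superdiagonal bands carry factors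
  \<open>phi\<close>.\<close>

lemma seqB_seqA_relation:
  "seqB a b c d (seqB a b c d (seqA a d f)) i - 2 * seqB a b c d (seqA a d (seqB a b c d f)) i
     + seqA a d (seqB a b c d (seqB a b c d f)) i
     - 2 * (seqB a b c d (seqA a d f) i + seqA a d (seqB a b c d f) i)
   = 2 * seqB a b c d (seqB a b c d f) i - 2 * deltaR a b c d * seqB a b c d f i
     + 2 * alphaR b a c d * f i"
proof (cases i)
  case 0
  have "phi a b c d 0 = 0" by (simp add: phi_def)
  then show ?thesis
    using phi_theta_diagonal_0[of b a c d]
      phi_second_diff[of a b c d 0] theta_second_diff[of a d 0]
    unfolding 0 seqA_def seqB_def nat.case phi_swap[of b a] deltaR_swap[of b a]
    by Groebner_Basis.algebra
next
  case (Suc j)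
  show ?thesis
    using theta_Suc_square[of b d j] phi_theta_diagonal_Suc[of b a c d j]
      phi_second_diff[of a b c d "Suc j"] theta_second_diff[of a d "Suc j"]
    unfolding Suc seqA_def seqB_def nat.case phi_swap[of b a] deltaR_swap[of b a]
    by Groebner_Basis.algebra
qed

lemma seqA_linear:
  "seqA a d (\<lambda>i. k * f i - g i - h i) i = k * seqA a d f i - seqA a d g i - seqA a d h i"
  by (cases i) (simp_all add: seqA_def algebra_simps)

lemma seqB_linear:
  "seqB a b c d (\<lambda>i. k * f i - g i - h i) i
     = k * seqB a b c d f i - seqB a b c d g i - seqB a b c d h i"
  by (simp add: seqB_def algebra_simps)

text \<open>Since C = delta - A - B, one has [C,[C,A]] = [B,[B,A]] - [A,[A,B]]; the relation is a
  combination of the previous two, and its constant is the difference of theirs.\<close>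

lemma seqC_seqA_relation:
  "seqC a b c d (seqC a b c d (seqA a d f)) i - 2 * seqC a b c d (seqA a d (seqC a b c d f)) i
     + seqA a d (seqC a b c d (seqC a b c d f)) i
     - 2 * (seqC a b c d (seqA a d f) i + seqA a d (seqC a b c d f) i)
   = 2 * seqC a b c d (seqC a b c d f) i - 2 * deltaR a b c d * seqC a b c d f i
     + 2 * (alphaR b a c d - alphaR a b c d) * f i"
proof -
  have C: "seqC a b c d = (\<lambda>f i. deltaR a b c d * f i - seqA a d f i - seqB a b c d f i)"
    by (intro ext) (simp add: seqC_def)
  have lin: "seqA a d (\<lambda>i. k * f i - g i - h i) = (\<lambda>i. k * seqA a d f i - seqA a d g i - seqA a d h i)"
    "seqB a b c d (\<lambda>i. k * f i - g i - h i)
     = (\<lambda>i. k * seqB a b c d f i - seqB a b c d g i - seqB a b c d h i)" for k f g h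
    by (intro ext seqA_linear seqB_linear)+
  show ?thesis
    using seqA_seqB_relation[of a d b c f i] seqB_seqA_relation[of a b c d f i]
    unfolding C lin by Groebner_Basis.algebra
qed

section \<open>Coincidence and adjacency of eigenvalues\<close>

lemma theta_diff:
  "theta x d i - theta x d j
     = (of_nat j - of_nat i) * (2 * x + of_nat d - of_nat i - of_nat j + 1)"
proof -
  obtain D m :: complex where v: "of_nat d / 2 = D" "of_nat d = 2 * D" "of_nat i = m"
    by (rule half_nat_obtain)
  obtain l :: complex where l: "of_nat j = l" by simp
  show ?thesis unfolding theta_def v(1) unfolding v l by Groebner_Basis.algebra
qed

lemma theta_reflect: "i \<le> d \<Longrightarrow> theta (- x - 1) d (d - i) = theta x d i"
  by (simp add: theta_def of_nat_diff field_simps)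

lemma bad_valuesI: "2 * x = of_nat k - of_nat d - 1 \<Longrightarrow> 1 \<le> k \<Longrightarrow> k + 1 \<le> 2 * d \<Longrightarrow> x \<in> bad_values d"
  unfolding bad_values_def by (auto intro!: exI[of _ k] simp: field_simps)

lemma bad_values_reflect: "- x - 1 \<in> bad_values d \<longleftrightarrow> x \<in> bad_values d"
proof -
  have "- y - 1 \<in> bad_values d" if "y \<in> bad_values d" for y
  proof -
    from that obtain k where k: "y = (of_nat k - of_nat d - 1) / 2" "1 \<le> k" "k + 1 \<le> 2 * d"
      unfolding bad_values_def by auto
    \<comment> \<open>The reflection of the parameter is k -> 2d - k on the index of the bad
      value.\<close>
    have "2 * (- y - 1) = of_nat (2 * d - k) - of_nat d - 1"
      using k by (simp add: of_nat_diff field_simps)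
    then show ?thesis by (rule bad_valuesI) (use k in auto)
  qed
  from this[of x] this[of "- x - 1"] show ?thesis by auto
qed

text \<open>By \<open>theta_diff\<close>, indices i and j different from each other collide exactly
  when 2x = i + j - d - 1, and the sums of two different indices in 0..d are exactly 1, ..., 2d -
  1.\<close>

lemma inj_on_theta_iff: "inj_on (theta x d) {..d} \<longleftrightarrow> x \<notin> bad_values d"
proof
  assume inj: "inj_on (theta x d) {..d}"
  show "x \<notin> bad_values d"
  proof
    assume "x \<in> bad_values d"
    then obtain k where k: "x = (of_nat k - of_nat d - 1) / 2" "1 \<le> k" "k + 1 \<le> 2 * d"
      unfolding bad_values_def by auto
    \<comment> \<open>Truncated subtraction splits k into two different indices at most d: 0 and k
      if k <= d, otherwise k - d and d.\<close>
    define i where "i = k - d"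
    define j where "j = k - i"
    have ij: "i \<le> d" "j \<le> d" "i \<noteq> j" "k = i + j" using k by (auto simp: i_def j_def)
    have "2 * x = of_nat i + of_nat j - of_nat d - 1" using k(1) ij(4) by (simp add: mult.commute)
    then have "theta x d i - theta x d j = 0" unfolding theta_diff by simp
    with inj ij show False by (auto dest: inj_onD)
  qed
next
  assume x: "x \<notin> bad_values d"
  show "inj_on (theta x d) {..d}"
  proof (rule inj_onI, rule ccontr)
    fix i j assume ij: "i \<in> {..d}" "j \<in> {..d}" "theta x d i = theta x d j" "i \<noteq> j"
    then have "2 * x + of_nat d - of_nat i - of_nat j + 1 = 0"
      using theta_diff[of x d i j] by simp
    then have "2 * x = of_nat (i + j) - of_nat d - 1"
      by (simp add: algebra_simps add_eq_0_iff)
    then have "x \<in> bad_values d" by (rule bad_valuesI) (use ij in auto)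
    with x show False by simp
  qed
qed

text \<open>The equation factors into four linear terms. Two say that i and j differ by 1; the other
  two make x the bad value with index i + j + 1 or i + j - 1, which is in range because |i - j| >=
  2.\<close>

lemma theta_adjacent:
  assumes x: "x \<notin> bad_values d" and ij: "i \<le> d" "j \<le> d"
    and eq: "(theta x d i - theta x d j)^2 = 2 * (theta x d i + theta x d j)"
  shows "i \<le> j + 1 \<and> j \<le> i + 1"
proof (rule ccontr)
  assume far: "\<not> ?thesis"
  obtain D m :: complex where v: "of_nat d / 2 = D" "of_nat d = 2 * D" "of_nat i = m"
    by (rule half_nat_obtain)
  obtain l :: complex where l: "of_nat j = l" by simp
  have "(of_nat j - of_nat i - 1) * (of_nat j - of_nat i + 1)
      * (2 * x + of_nat d - of_nat i - of_nat j) * (2 * x + of_nat d - of_nat i - of_nat j + 2) = 0"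
    using eq unfolding theta_def v(1) unfolding v l by Groebner_Basis.algebra
  then consider "of_nat j - of_nat i - (1::complex) = 0" | "of_nat j - of_nat i + (1::complex) = 0"
    | "2 * x + of_nat d - of_nat i - of_nat j = 0" | "2 * x + of_nat d - of_nat i - of_nat j + 2 = 0"
    by (auto simp only: mult_eq_0_iff)
  then show False
  proof cases
    case 1
    then have "of_nat j = (of_nat (i + 1) :: complex)" by (simp add: algebra_simps)
    then have "j = i + 1" by (simp only: of_nat_eq_iff)
    then show ?thesis using far by simp
  next
    case 2
    then have "of_nat (j + 1) = (of_nat i :: complex)" by (simp add: algebra_simps)
    then have "j + 1 = i" by (simp only: of_nat_eq_iff)
    then show ?thesis using far by simp
  next
    case 3
    then have "2 * x = of_nat (i + j + 1) - of_nat d - 1" by (simp add: algebra_simps)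
    then have "x \<in> bad_values d" by (rule bad_valuesI) (use ij far in auto)
    with x show ?thesis by simp
  next
    case 4
    then have "2 * x + 2 = of_nat (i + j) - of_nat d" by (simp add: algebra_simps)
    moreover have "i + j \<ge> 1" using far by auto
    ultimately have "2 * x = of_nat (i + j - 1) - of_nat d - 1"
      by (simp add: of_nat_diff algebra_simps)
    then have "x \<in> bad_values d" by (rule bad_valuesI) (use ij far in auto)
    with x show ?thesis by simp
  qed
qed

section \<open>Diagonalizability of the bidiagonal matrix A\<close>

definition theta_mat :: "complex \<Rightarrow> nat \<Rightarrow> complex mat" where
  "theta_mat x d = mat (d+1) (d+1) (\<lambda>(i,j). if i = j then theta x d i else 0)"

lemma theta_mat_carrier [simp]: "theta_mat x d \<in> carrier_mat (d+1) (d+1)"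
  by (simp add: theta_mat_def)

lemma diagonal_theta_mat: "diagonal_mat (theta_mat x d)"
  by (auto simp: diagonal_mat_def theta_mat_def)

lemma mult_diagonal_mat_index:
  assumes "W \<in> carrier_mat n n" "D \<in> carrier_mat n n" "diagonal_mat D" "i < n" "j < n"
  shows "(W * D) $$ (i,j) = W $$ (i,j) * (D $$ (j,j) :: complex)"
proof -
  have "(W * D) $$ (i,j) = (\<Sum>k\<in>{0..<n}. W $$ (i,k) * D $$ (k,j))"
    using assms by (auto simp: scalar_prod_def)
  also have "\<dots> = (\<Sum>k\<in>{0..<n}. if k = j then W $$ (i,j) * D $$ (j,j) else 0)"
    using assms by (intro sum.cong) (auto simp: diagonal_mat_def)
  finally show ?thesis using assms by simp
qed

lemma diagonal_mat_mult_vec_index: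
  assumes "D \<in> carrier_mat n n" "diagonal_mat D" "v \<in> carrier_vec n" "i < n"
  shows "(D *\<^sub>v v) $ i = D $$ (i,i) * (v $ i :: complex)"
proof -
  have "(D *\<^sub>v v) $ i = (\<Sum>k\<in>{0..<n}. D $$ (i,k) * v $ k)"
    using assms by (auto simp: scalar_prod_def)
  also have "\<dots> = (\<Sum>k\<in>{0..<n}. if k = i then D $$ (i,i) * v $ i else 0)"
    using assms by (intro sum.cong) (auto simp: diagonal_mat_def)
  finally show ?thesis using assms by simp
qed

lemma mult_mat_unit_vec:
  fixes A :: "complex mat"
  shows "A \<in> carrier_mat n m \<Longrightarrow> i < m \<Longrightarrow> A *\<^sub>v unit_vec m i = col A i"
  by (intro eq_vecI) auto

lemma mult_RA_index:
  assumes "W \<in> carrier_mat (d+1) (d+1)" "k \<le> d" "i \<le> d"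
  shows "(W * RA x b c d) $$ (k,i)
      = theta x d i * W $$ (k,i) + (if i < d then W $$ (k, Suc i) else 0)"
proof -
  have "(W * RA x b c d) $$ (k,i) = (\<Sum>j\<in>{0..<d+1}. W $$ (k,j) * RA x b c d $$ (j,i))"
    using assms by (auto simp: scalar_prod_def)
  also have "\<dots> = (\<Sum>j\<in>{0..<d+1}. (if j = i then theta x d i * W $$ (k,i) else 0)
      + (if j = Suc i then W $$ (k, Suc i) else 0))"
    using assms by (intro sum.cong) (auto simp: RA_def)
  also have "\<dots> = theta x d i * W $$ (k,i) + (if i < d then W $$ (k, Suc i) else 0)"
    using assms by (simp add: sum.distrib)
  finally show ?thesis .
qed

lemma similar_mat_wit_of_intertwiner:
  fixes M :: "complex mat"
  assumes M: "M \<in> carrier_mat n n" and L: "L \<in> carrier_mat n n" and P: "P \<in> carrier_mat n n"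
    and det: "det P \<noteq> 0" and eq: "M * P = P * L"
  shows "\<exists>Q. similar_mat_wit M L P Q"
proof -
  from det_non_zero_imp_unit[OF P det, of "()"]
  obtain Q where Q: "Q \<in> carrier_mat n n" "P * Q = 1\<^sub>m n" "Q * P = 1\<^sub>m n"
    by (auto simp: Units_def ring_mat_simps)
  have "M = M * (P * Q)" using M Q by simp
  also have "\<dots> = P * L * Q" using M P Q(1) eq by (simp flip: assoc_mult_mat)
  finally show ?thesis using similar_mat_witI[OF Q(2,3) _ M L P Q(1)] by blast
qed

text \<open>In the basis of a chain with (M - theta_i) w_i = w_(i+1) that stops after w_d, the
  operator M has exactly the matrix \<open>RA x b c d\<close>. Both B and C are treated by
  exhibiting such a chain.\<close>

lemma similar_RA_of_chain:
  assumes M: "M \<in> carrier_mat (d+1) (d+1)"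
    and F: "\<And>f. M *\<^sub>v vec (d+1) f = vec (d+1) (F f)"
    and chain: "\<And>i k. i \<le> d \<Longrightarrow> k \<le> d \<Longrightarrow> F (w i) k = theta x d i * w i k + w (Suc i) k"
    and last: "\<And>k. k \<le> d \<Longrightarrow> w (Suc d) k = 0"
    and det: "det (mat (d+1) (d+1) (\<lambda>(k,i). w i k)) \<noteq> 0"
  shows "similar_mat M (RA x b c d)"
proof -
  let ?P = "mat (d+1) (d+1) (\<lambda>(k,i). w i k)"
  have P: "?P \<in> carrier_mat (d+1) (d+1)" by simp
  have "M * ?P = ?P * RA x b c d"
  proof (rule eq_matI, goal_cases)
    case (1 k i)
    then have ki: "k \<le> d" "i \<le> d" by auto
    have "(M * ?P) $$ (k,i) = (M *\<^sub>v col ?P i) $ k"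
      using M ki by simp
    also have "col ?P i = vec (d+1) (w i)" using ki by auto
    also have "(M *\<^sub>v vec (d+1) (w i)) $ k = theta x d i * w i k + w (Suc i) k"
      unfolding F using ki by (simp add: chain)
    also have "\<dots> = (?P * RA x b c d) $$ (k,i)"
      using ki last[of k] mult_RA_index[OF P ki] by (cases "i = d") auto
    finally show ?case .
  qed (use M in auto)
  from similar_mat_wit_of_intertwiner[OF M _ P det this] show ?thesis
    unfolding similar_mat_def by auto
qed

lemma RA_similar_theta_mat:
  assumes x: "x \<notin> bad_values d"
  shows "similar_mat (RA x b c d) (theta_mat x d)"
proof -
  \<comment> \<open>Coordinates of the j-th eigenvector of A: they solve (theta_j - theta_i) p_i =
    p_(i-1) for i > j, starting with 1 at index j. Hence the matrix of eigenvectors is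
    unitriangular.\<close>
  define p where "p j i = (if j \<le> i then \<Prod>h\<in>{j<..i}. 1 / (theta x d j - theta x d h) else 0)" for j i
  let ?P = "mat (d+1) (d+1) (\<lambda>(i,j). p j i)"
  have P: "?P \<in> carrier_mat (d+1) (d+1)" by simp
  have "det ?P = prod_list (diag_mat ?P)"
    by (rule det_lower_triangular[OF _ P]) (auto simp: p_def)
  also have "diag_mat ?P = map (\<lambda>_. 1) [0..<d+1]"
    by (auto simp: diag_mat_def p_def)
  finally have det: "det ?P \<noteq> 0" by auto
  have eig: "seqA x d (p j) i = theta x d j * p j i" if "i \<le> d" "j \<le> d" for i j
  proof (cases i)
    case 0
    then show ?thesis by (auto simp: seqA_def p_def)
  next
    case (Suc m)
    consider "j = i" | "j < i" | "i < j" by linarith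
    then show ?thesis
    proof cases
      case 2
      have "theta x d j \<noteq> theta x d i"
        using x that 2 inj_onD[of "theta x d" "{..d}" j i] by (auto simp: inj_on_theta_iff)
      moreover have "{j<..i} = insert i {j<..m}" using 2 Suc by auto
      then have "p j i = p j m / (theta x d j - theta x d i)"
        using 2 Suc by (simp add: p_def)
      ultimately show ?thesis using Suc by (simp add: seqA_def field_simps)
    qed (auto simp: seqA_def p_def Suc)
  qed
  have "RA x b c d * ?P = ?P * theta_mat x d"
  proof (rule eq_matI, goal_cases)
    case (1 i j)
    then have ij: "i \<le> d" "j \<le> d" by (auto simp: theta_mat_def)
    have "(RA x b c d * ?P) $$ (i,j) = (RA x b c d *\<^sub>v col ?P j) $ i"
      using ij by simp
    also have "col ?P j = vec (d+1) (p j)" using ij by auto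
    also have "(RA x b c d *\<^sub>v vec (d+1) (p j)) $ i = theta x d j * p j i"
      unfolding RA_mult_vec using ij by (simp add: eig)
    also have "\<dots> = (?P * theta_mat x d) $$ (i,j)"
      using ij by (subst mult_diagonal_mat_index[OF P theta_mat_carrier diagonal_theta_mat])
        (auto simp: theta_mat_def)
    finally show ?case .
  qed (auto simp: theta_mat_def)
  from similar_mat_wit_of_intertwiner[OF R_carrier(1) theta_mat_carrier P det this] show ?thesis
    unfolding similar_mat_def by auto
qed

lemma diagonalizable_iff_similar:
  assumes M: "M \<in> carrier_mat n n"
  shows "diagonalizable n M \<longleftrightarrow> (\<exists>D. similar_mat M D \<and> diagonal_mat D)"
proof
  assume "diagonalizable n M"
  then obtain P Q where b: "basis_change n P Q" and d: "diagonal_mat (Q * M * P)"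
    unfolding diagonalizable_def by auto
  from b have PQ: "P \<in> carrier_mat n n" "Q \<in> carrier_mat n n" "P * Q = 1\<^sub>m n" "Q * P = 1\<^sub>m n"
    by (auto simp: basis_change_def)
  have "similar_mat_wit (Q * M * P) M Q P"
    by (rule similar_mat_witI[OF PQ(4,3) refl]) (use PQ M in auto)
  then show "\<exists>D. similar_mat M D \<and> diagonal_mat D"
    using d similar_mat_wit_sym unfolding similar_mat_def by blast
next
  assume "\<exists>D. similar_mat M D \<and> diagonal_mat D"
  then obtain D P Q where w: "similar_mat_wit M D P Q" and d: "diagonal_mat D"
    unfolding similar_mat_def by auto
  have "similar_mat_wit D M Q P" by (rule similar_mat_wit_sym[OF w])
  then show "diagonalizable n M"
    using similar_mat_witD2[OF M w] similar_mat_witD(3)[OF refl \<open>similar_mat_wit D M Q P\<close>] d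
    unfolding diagonalizable_def basis_change_def by metis
qed

text \<open>The eigenvector equation reads f_(i-1) = (mu - theta_i) f_i. If mu is no eigenvalue,
  zeros propagate upwards from index 0; if the last coordinate is zero, they propagate downwards. So
  an eigenvector is determined by its last coordinate.\<close>

lemma seqA_eigenvector_eq_0:
  assumes eig: "\<And>i. i \<le> d \<Longrightarrow> seqA x d f i = \<mu> * f i"
    and "\<mu> \<notin> theta x d ` {..d} \<or> f d = 0" and "i \<le> d"
  shows "f i = 0"
  using assms(2)
proof
  assume mu: "\<mu> \<notin> theta x d ` {..d}"
  show ?thesis using \<open>i \<le> d\<close>
  proof (induction i)
    case 0
    then show ?case using eig[of 0] mu by (auto simp: seqA_def)
  next
    case (Suc i)
    then have "theta x d (Suc i) * f (Suc i) = \<mu> * f (Suc i)"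
      using eig[of "Suc i"] by (simp add: seqA_def)
    moreover have "\<mu> \<noteq> theta x d (Suc i)" using mu Suc.prems by auto
    ultimately show ?case by simp
  qed
next
  assume "f d = 0"
  with \<open>i \<le> d\<close> show ?thesis
  proof (induction rule: inc_induct)
    case (step n)
    then show ?case using eig[of "Suc n"] by (simp add: seqA_def)
  qed
qed

text \<open>The columns of P are d + 1 independent eigenvectors. As eigenspaces are lines, their
  eigenvalues are pairwise different, and all of them occur among the \<open>theta x d i\<close>;
  these are then pairwise different too.\<close>

lemma RA_similar_diagonal_imp_not_bad:
  assumes "similar_mat (RA x b c d) D" "diagonal_mat D"
  shows "x \<notin> bad_values d"
proof -
  let ?n = "d + 1"
  from assms(1) obtain P Q where w: "similar_mat_wit (RA x b c d) D P Q"
    unfolding similar_mat_def by auto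
  from similar_mat_witD2[OF R_carrier(1) w]
  have PQ: "P * Q = 1\<^sub>m ?n" "Q * P = 1\<^sub>m ?n" "RA x b c d = P * D * Q"
    and car: "D \<in> carrier_mat ?n ?n" "P \<in> carrier_mat ?n ?n" "Q \<in> carrier_mat ?n ?n" by auto
  have "RA x b c d * P = P * D * (Q * P)"
    unfolding PQ(3) using car by (intro assoc_mult_mat) auto
  then have RP: "RA x b c d * P = P * D" using PQ(2) car by simp
  define p where "p j i = P $$ (i,j)" for i j
  have col: "col P j = vec ?n (p j)" if "j \<le> d" for j
    using car that by (auto simp: p_def)
  have eig: "seqA x d (p j) i = D $$ (j,j) * p j i" if "i \<le> d" "j \<le> d" for i j
  proof -
    have "seqA x d (p j) i = (RA x b c d *\<^sub>v col P j) $ i"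
      unfolding col[OF that(2)] RA_mult_vec using that by simp
    also have "\<dots> = (RA x b c d * P) $$ (i,j)"
      using that car by simp
    also have "\<dots> = D $$ (j,j) * p j i"
      unfolding RP using that
      by (subst mult_diagonal_mat_index[OF car(2,1) assms(2)]) (auto simp: p_def)
    finally show ?thesis .
  qed
  have QPv: "Q *\<^sub>v (P *\<^sub>v v) = v" if "v \<in> carrier_vec ?n" for v
    using that car PQ(2) by (simp flip: assoc_mult_mat_vec)
  have indep: "v = 0\<^sub>v ?n" if "v \<in> carrier_vec ?n" "P *\<^sub>v v = 0\<^sub>v ?n" for v
    using QPv[OF that(1)] that(2) car by auto
  have nz: "\<exists>i\<le>d. p j i \<noteq> 0" if "j \<le> d" for j
  proof (rule ccontr)
    assume "\<not> ?thesis"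
    then have "P *\<^sub>v unit_vec ?n j = 0\<^sub>v ?n"
      using that car col[OF that] by (auto simp: mult_mat_unit_vec)
    from indep[OF _ this] have "unit_vec ?n j $ j = (0::complex)" using that by simp
    then show False using that by simp
  qed
  have last: "p j d \<noteq> 0" if "j \<le> d" for j
    using seqA_eigenvector_eq_0[of d x "p j" "D $$ (j,j)"] eig nz[OF that] that by blast
  have range: "D $$ (j,j) \<in> theta x d ` {..d}" if "j \<le> d" for j
    using seqA_eigenvector_eq_0[of d x "p j" "D $$ (j,j)"] eig nz[OF that] that by blast
  have inj: "inj_on (\<lambda>j. D $$ (j,j)) {..d}"
  proof (rule inj_onI, rule ccontr)
    fix j k assume jk: "j \<in> {..d}" "k \<in> {..d}" "D $$ (j,j) = D $$ (k,k)" "j \<noteq> k"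
    \<comment> \<open>Two eigenvectors for the same eigenvalue are combined so that the last
      coordinate cancels. The combination is therefore zero, while its coefficient vector
      \<open>v\<close> is not.\<close>
    define f where "f i = p k d * p j i - p j d * p k i" for i
    define v where "v = p k d \<cdot>\<^sub>v unit_vec ?n j - p j d \<cdot>\<^sub>v unit_vec ?n k"
    have "seqA x d f i = p k d * seqA x d (p j) i - p j d * seqA x d (p k) i" for i
      by (cases i) (auto simp: seqA_def f_def algebra_simps)
    then have "seqA x d f i = D $$ (j,j) * f i" if "i \<le> d" for i
      using that jk by (simp add: eig) (simp add: f_def algebra_simps)
    then have f0: "f i = 0" if "i \<le> d" for i
      using seqA_eigenvector_eq_0[of d x f "D $$ (j,j)"] that by (auto simp: f_def)
    have "P *\<^sub>v v = p k d \<cdot>\<^sub>v col P j - p j d \<cdot>\<^sub>v col P k"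
      unfolding v_def using jk car
      by (subst mult_minus_distrib_mat_vec[OF car(2)]) (auto simp: mult_mat_unit_vec)
    also have "\<dots> = 0\<^sub>v ?n"
      using jk f0 by (auto simp: col f_def)
    finally have Pv: "P *\<^sub>v v = 0\<^sub>v ?n" .
    have "v \<in> carrier_vec ?n" by (simp add: v_def)
    from indep[OF this Pv] have "v = 0\<^sub>v ?n" .
    then have "v $ j = 0" using jk by simp
    then show False using jk last[of k] by (simp add: v_def)
  qed
  have "d + 1 = card ((\<lambda>j. D $$ (j,j)) ` {..d})"
    using card_image[OF inj] by simp
  also have "\<dots> \<le> card (theta x d ` {..d})"
    using range by (intro card_mono) auto
  finally have "card (theta x d ` {..d}) = card {..d}"
    using card_image_le[of "{..d}" "theta x d"] by simp
  then have "inj_on (theta x d) {..d}" by (intro eq_card_imp_inj_on) auto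
  then show ?thesis by (simp add: inj_on_theta_iff)
qed

lemma diagonalizable_iff_of_similar_RA:
  assumes M: "M \<in> carrier_mat (d+1) (d+1)" and sim: "similar_mat M (RA x b c d)"
  shows "diagonalizable (d+1) M \<longleftrightarrow> x \<notin> bad_values d"
  unfolding diagonalizable_iff_similar[OF M]
  using RA_similar_diagonal_imp_not_bad[of x b c d] RA_similar_theta_mat[of x d b c] diagonal_theta_mat[of x d]
    similar_mat_trans[OF sim] similar_mat_trans[OF similar_mat_sym[OF sim]] by blast

section \<open>Chains that bring B and C to the shape of A\<close>

lemma RB_similar_RA:
  assumes phi: "\<And>i. 1 \<le> i \<Longrightarrow> i \<le> d \<Longrightarrow> phi a b c d i \<noteq> 0"
  shows "similar_mat (RB a b c d) (RA (- b - 1) b c d)"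
proof -
  \<comment> \<open>\<open>w i\<close> is a multiple of the basis vector with index d - i. B sends
    e_k to its eigenvalue times e_k plus phi_k e_(k-1), so the scalar collects the
    \<open>phi\<close> passed on the way down from d.\<close>
  define w where "w i k = (if k + i = d then \<Prod>h\<in>{k<..d}. phi a b c d h else 0)" for i k
  show ?thesis
  proof (rule similar_RA_of_chain[OF R_carrier(2) RB_mult_vec, where w = w])
    fix i k assume ik: "i \<le> d" "k \<le> d"
    consider "k + i = d" | "Suc k + i = d" | "k + i \<noteq> d" "Suc k + i \<noteq> d" by blast
    then show "seqB a b c d (w i) k = theta (- b - 1) d i * w i k + w (Suc i) k"
    proof cases
      case 1
      then have "theta (- b - 1) d i = theta b d k"
        using theta_reflect[of k d b] by (metis add_diff_cancel_left' ik(2))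
      with 1 show ?thesis by (auto simp: seqB_def w_def)
    next
      case 2
      then have "{k<..d} = insert (Suc k) {Suc k<..d}" by auto
      with 2 show ?thesis by (auto simp: seqB_def w_def)
    qed (auto simp: seqB_def w_def)
  next
    let ?P = "mat (d+1) (d+1) (\<lambda>(k,i). w i k)"
    have P: "?P \<in> carrier_mat (d+1) (d+1)" by simp
    show "det ?P \<noteq> 0"
      \<comment> \<open>The matrix is antidiagonal, not triangular, so its kernel is computed
        instead: each coordinate of the image is a nonzero multiple of one coordinate of
        \<open>v\<close>.\<close>
      unfolding det_0_iff_vec_prod_zero_field[OF P]
    proof safe
      fix v assume v: "v \<in> carrier_vec (d+1)" "v \<noteq> 0\<^sub>v (d+1)" "?P *\<^sub>v v = 0\<^sub>v (d+1)"
      have "v $ i = 0" if i: "i \<le> d" for i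
      proof -
        have "0 = (?P *\<^sub>v v) $ (d - i)" using v(3) i by simp
        also have "\<dots> = (\<Sum>l\<in>{0..<d+1}. w l (d - i) * v $ l)"
          using v(1) i by (auto simp: scalar_prod_def)
        also have "\<dots> = (\<Sum>l\<in>{0..<d+1}. if l = i then w i (d - i) * v $ i else 0)"
          using i by (intro sum.cong) (auto simp: w_def)
        also have "\<dots> = w i (d - i) * v $ i" using i by simp
        finally show ?thesis using i phi by (auto simp: w_def)
      qed
      then have "v = 0\<^sub>v (d+1)" using v(1) by (intro eq_vecI) auto
      with v(2) show False by simp
    qed
  qed (auto simp: w_def)
qed

text \<open>With s = a + b + c this is a factor of phi: phi_h = - h *
  \<open>chain_factor s d h\<close> * (a + b - c + d/2 - h + 1). It vanishes at h = d + 1, which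
  ends the chain for C.\<close>

definition chain_factor :: "complex \<Rightarrow> nat \<Rightarrow> nat \<Rightarrow> complex" where
  "chain_factor s d h = (of_nat d - of_nat h + 1) * (s + of_nat d / 2 + 2 - of_nat h)"

lemma choose_Suc_mult: "k \<le> n \<Longrightarrow> (n + 1 - k) * ((n + 1) choose k) = (n + 1) * (n choose k)"
  for n k :: nat
  using binomial_absorb_comp[of "n + 1" k] by simp

lemma binomial_Suc_mult: "Suc k * (n choose Suc k) = (n - k) * (n choose k)"
  by (simp only: binomial_absorption binomial_absorb_comp)

text \<open>The coordinate k of w_(i+1) = (C - theta_i) w_i, multiplied by i + 1 - k and divided by
  the common binomial coefficient and product.\<close>

lemma chain_coeff_identity:
  fixes a b c :: complex
  shows "- (of_nat i + 1) * chain_factor (a + b + c) d (Suc i)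
    = (of_nat i + 1 - of_nat k)
        * (deltaR a b c d - theta a d k - theta b d k - theta c d i
           + (of_nat i - of_nat k) * (a + b - c + of_nat d / 2 - of_nat k))
      - of_nat k * chain_factor (a + b + c) d k"
proof -
  obtain D m :: complex where v: "of_nat d / 2 = D" "of_nat d = 2 * D" "of_nat i = m"
    by (rule half_nat_obtain)
  obtain l :: complex where l: "of_nat k = l" by simp
  show ?thesis unfolding theta_def deltaR_def chain_factor_def of_nat_Suc v(1)
    unfolding v l by Groebner_Basis.algebra
qed

lemma RC_similar_RA: "similar_mat (RC a b c d) (RA c b c' d)"
proof -
  define r where "r = chain_factor (a + b + c) d"
  \<comment> \<open>The closed form of the chain from the overview; the recursion is now checked
    coordinate by coordinate.\<close>
  define w where "w i k = (-1) ^ i * of_nat (i choose k) * (\<Prod>h\<in>{k<..i}. r h)" for i k :: nat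
  have phi: "phi a b c d (Suc k) = - of_nat (Suc k) * r (Suc k) * (a + b - c + of_nat d / 2 - of_nat k)" for k
  proof -
    obtain D m :: complex where v: "of_nat d / 2 = D" "of_nat d = 2 * D" "of_nat k = m"
      by (rule half_nat_obtain)
    show ?thesis unfolding phi_def r_def chain_factor_def of_nat_Suc v(1)
      unfolding v by Groebner_Basis.algebra
  qed
  show ?thesis
  proof (rule similar_RA_of_chain[OF R_carrier(3) RC_mult_vec, where w = w])
    fix i k assume ik: "i \<le> d" "k \<le> d"
    define E where "E = deltaR a b c d - theta a d k - theta b d k - theta c d i"
    define g where "g = a + b - c + of_nat d / 2 - of_nat k"
    define prev where "prev = (case k of 0 \<Rightarrow> 0 | Suc j \<Rightarrow> w i j)"
    have "w (Suc i) k = E * w i k - prev - phi a b c d (Suc k) * w i (Suc k)"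
    proof (cases "k \<le> i")
      case False
      then show ?thesis
        \<comment> \<open>Above the support of \<open>w i\<close> only k = i + 1 contributes, where
          the new leading sign comes from \<open>prev\<close>.\<close>
        by (cases "k = Suc i") (auto simp: w_def prev_def binomial_eq_0 split: nat.splits)
    next
      case True
      define R where "R = (-1) ^ i * (\<Prod>h\<in>{k<..i}. r h)"
      define X :: complex where "X = of_nat (i choose k)"
      \<comment> \<open>\<open>X * R\<close> is the part shared by all terms. The factor
        \<open>N\<close> turns the neighbouring binomials (i+1 choose k) and (i choose k-1) into
        multiples of \<open>X\<close>; the term with k + 1 is absorbed by the factor k + 1 of
        \<open>phi\<close>.\<close>
      define N :: complex where "N = of_nat i + 1 - of_nat k"
      have Nn: "N = of_nat (Suc i - k)" using True by (simp add: N_def of_nat_diff)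
      have "Suc i - k \<noteq> 0" using True by simp
      then have N0: "N \<noteq> 0" unfolding Nn of_nat_eq_0_iff .
      have wik: "w i k = X * R" by (simp add: w_def R_def X_def)
      have "{k<..Suc i} = insert (Suc i) {k<..i}" using True by auto
      then have "w (Suc i) k = - of_nat (Suc i choose k) * r (Suc i) * R"
        by (simp add: w_def R_def)
      moreover have "N * of_nat (Suc i choose k) = (of_nat i + 1) * X"
        using arg_cong[OF choose_Suc_mult[OF True], of "of_nat :: nat \<Rightarrow> complex"]
        by (simp only: Nn X_def of_nat_mult of_nat_add of_nat_1 Suc_eq_plus1)
      ultimately have 1: "N * w (Suc i) k = - (of_nat i + 1) * r (Suc i) * (X * R)"
        by Groebner_Basis.algebra
      have 2: "N * prev = of_nat k * r k * (X * R)"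
      proof (cases k)
        case 0
        then show ?thesis by (simp add: prev_def)
      next
        case (Suc j)
        have "{j<..i} = insert k {k<..i}" using True Suc by auto
        then have "prev = of_nat (i choose j) * r k * R"
          by (simp add: prev_def Suc w_def R_def)
        moreover have "N * of_nat (i choose j) = of_nat k * X"
          using arg_cong[OF binomial_Suc_mult[of j i, symmetric], of "of_nat :: nat \<Rightarrow> complex"]
          by (simp only: Nn X_def Suc of_nat_mult diff_Suc_Suc)
        ultimately show ?thesis by Groebner_Basis.algebra
      qed
      have 3: "phi a b c d (Suc k) * w i (Suc k) = - ((of_nat i - of_nat k) * g * (X * R))"
      proof (cases "k = i")
        case True
        then show ?thesis by (simp add: w_def)
      next
        case False
        then have "{k<..i} = insert (Suc k) {Suc k<..i}" using True by auto
        then have R: "R = (-1) ^ i * (r (Suc k) * (\<Prod>h\<in>{Suc k<..i}. r h))" by (simp add: R_def)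
        have ch: "of_nat (Suc k) * of_nat (i choose Suc k) = (of_nat i - of_nat k) * X"
          using arg_cong[OF binomial_Suc_mult[of k i], of "of_nat :: nat \<Rightarrow> complex"] \<open>k \<le> i\<close>
          by (simp only: X_def of_nat_mult of_nat_diff)
        have "phi a b c d (Suc k) * w i (Suc k)
            = - (of_nat (Suc k) * of_nat (i choose Suc k)) * g * ((-1) ^ i * (r (Suc k) * (\<Prod>h\<in>{Suc k<..i}. r h)))"
          unfolding phi w_def g_def by (simp add: algebra_simps)
        then show ?thesis unfolding ch R by simp
      qed
      have "- (of_nat i + 1) * r (Suc i) = N * (E + (of_nat i - of_nat k) * g) - of_nat k * r k"
        using chain_coeff_identity[of i a b c d k] unfolding r_def N_def E_def g_def .
      then have "N * w (Suc i) k = N * (E * w i k - prev - phi a b c d (Suc k) * w i (Suc k))"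
        using 1 2 3 wik by Groebner_Basis.algebra
      with N0 show ?thesis by simp
    qed
    then show "seqC a b c d (w i) k = theta c d i * w i k + w (Suc i) k"
      by (simp add: seqC_def seqA_def seqB_def E_def prev_def algebra_simps)
  next
    fix k assume "k \<le> d"
    moreover have "r (Suc d) = 0" by (simp add: r_def chain_factor_def)
    ultimately have "(\<Prod>h\<in>{k<..Suc d}. r h) = 0" by (intro prod_zero) auto
    then show "w (Suc d) k = 0" by (simp add: w_def)
  next
    let ?P = "mat (d+1) (d+1) (\<lambda>(k,i). w i k)"
    \<comment> \<open>Binomials vanish above i, so the matrix is upper triangular with signs on its
      diagonal.\<close>
    have "det ?P = prod_list (diag_mat ?P)"
      by (rule det_upper_triangular) (auto simp: w_def upper_triangular_def)
    also have "diag_mat ?P = map (\<lambda>i. (-1) ^ i) [0..<d+1]"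
      by (auto simp: diag_mat_def w_def)
    finally show "det ?P \<noteq> 0" by auto
  qed
qed

section \<open>Invariant subspaces and tridiagonal shape in an eigenbasis\<close>

text \<open>The subspace consists of the vectors whose new coordinates in \<open>S\<close> vanish;
  the zero block keeps coordinates outside \<open>S\<close> from feeding into \<open>S\<close>. It
  contains the new basis vectors outside \<open>S\<close> and misses those in
  \<open>S\<close>.\<close>

lemma invariant_coordinate_subspace:
  fixes M N :: "complex mat"
  assumes M: "M \<in> carrier_mat n n" and N: "N \<in> carrier_mat n n"
    and PQ: "basis_change n P Q"
    and S: "S \<subseteq> {..<n}" "S \<noteq> {}" "S \<noteq> {..<n}"
    and M0: "\<And>k l. k \<in> S \<Longrightarrow> l < n \<Longrightarrow> l \<notin> S \<Longrightarrow> (Q * M * P) $$ (k,l) = 0"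
    and N0: "\<And>k l. k \<in> S \<Longrightarrow> l < n \<Longrightarrow> l \<notin> S \<Longrightarrow> (Q * N * P) $$ (k,l) = 0"
  shows "\<exists>W. is_subspace n W \<and> invariant_under M W \<and> invariant_under N W
    \<and> W \<noteq> {0\<^sub>v n} \<and> W \<noteq> carrier_vec n"
proof -
  from PQ have P: "P \<in> carrier_mat n n" and Q: "Q \<in> carrier_mat n n"
    and id: "P * Q = 1\<^sub>m n" "Q * P = 1\<^sub>m n" by (auto simp: basis_change_def)
  define W where "W = {v \<in> carrier_vec n. \<forall>k\<in>S. (Q *\<^sub>v v) $ k = 0}"
  have inv: "invariant_under L W" if L: "L \<in> carrier_mat n n"
    and L0: "\<And>k l. k \<in> S \<Longrightarrow> l < n \<Longrightarrow> l \<notin> S \<Longrightarrow> (Q * L * P) $$ (k,l) = 0" for L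
    unfolding invariant_under_def
  proof
    fix v assume "v \<in> W"
    then have v: "v \<in> carrier_vec n" and v0: "\<And>k. k \<in> S \<Longrightarrow> (Q *\<^sub>v v) $ k = 0"
      by (auto simp: W_def)
    have "Q *\<^sub>v (L *\<^sub>v v) = Q *\<^sub>v (L *\<^sub>v ((P * Q) *\<^sub>v v))" using v id by simp
    also have "\<dots> = (Q * L * P) *\<^sub>v (Q *\<^sub>v v)"
      using v P Q L by (simp add: assoc_mult_mat_vec[where ?n\<^sub>1.0 = n and ?n\<^sub>2.0 = n and ?n\<^sub>3.0 = n])
    finally have eq: "Q *\<^sub>v (L *\<^sub>v v) = (Q * L * P) *\<^sub>v (Q *\<^sub>v v)" .
    have "(Q *\<^sub>v (L *\<^sub>v v)) $ k = 0" if "k \<in> S" for k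
    proof -
      have "(Q *\<^sub>v (L *\<^sub>v v)) $ k = (\<Sum>l\<in>{0..<n}. (Q * L * P) $$ (k,l) * (Q *\<^sub>v v) $ l)"
        unfolding eq using that S(1) P Q L by (auto simp: scalar_prod_def)
      also have "\<dots> = 0"
        using that L0[OF that] v0 by (intro sum.neutral) force
      finally show ?thesis .
    qed
    then show "L *\<^sub>v v \<in> W" using L v by (auto simp: W_def)
  qed
  have "is_subspace n W"
    unfolding is_subspace_def W_def
  proof (intro conjI ballI allI, goal_cases)
    case (3 u v)
    then have uv: "u \<in> carrier_vec n" "v \<in> carrier_vec n" by auto
    have "(Q *\<^sub>v (u + v)) $ k = (Q *\<^sub>v u) $ k + (Q *\<^sub>v v) $ k" if "k \<in> S" for k
      unfolding mult_add_distrib_mat_vec[OF Q uv] using Q S(1) that by (intro index_add_vec) auto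
    then show ?case using 3 by auto
  next
    case (4 k u)
    then show ?case using Q S(1) by (auto simp: mult_mat_vec[OF Q] subset_iff)
  qed (use Q S(1) in auto)
  moreover have QP: "Q *\<^sub>v (P *\<^sub>v unit_vec n l) = unit_vec n l" for l
    using P Q id by (simp flip: assoc_mult_mat_vec)
  have "W \<noteq> {0\<^sub>v n}"
  proof
    assume W: "W = {0\<^sub>v n}"
    from S obtain l where l: "l < n" "l \<notin> S" by auto
    then have "P *\<^sub>v unit_vec n l \<in> W" using P S(1) by (auto simp: W_def QP)
    then have "P *\<^sub>v unit_vec n l = 0\<^sub>v n" using W by simp
    moreover have "Q *\<^sub>v 0\<^sub>v n = 0\<^sub>v n" using Q by (intro eq_vecI) auto
    ultimately have "unit_vec n l = (0\<^sub>v n :: complex vec)" using QP[of l] by simp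
    then have "(unit_vec n l :: complex vec) $ l = 0" using l by simp
    then show False using l by simp
  qed
  moreover have "W \<noteq> carrier_vec n"
  proof
    assume W: "W = carrier_vec n"
    from S obtain k where k: "k < n" "k \<in> S" by auto
    then have "P *\<^sub>v unit_vec n k \<in> W" using P W by auto
    then have "(unit_vec n k :: complex vec) $ k = 0" using k by (auto simp: W_def QP)
    then show False using k by simp
  qed
  ultimately show ?thesis using inv[OF M M0] inv[OF N N0] by blast
qed

text \<open>Here the relation is read in the eigenbasis of M to locate the nonzero entries of N;
  irreducibility then excludes zeros next to the diagonal.\<close>

lemma eigenbasis_irred_tridiagonal:
  fixes M N :: "complex mat"
  assumes M: "M \<in> carrier_mat (d+1) (d+1)" and N: "N \<in> carrier_mat (d+1) (d+1)"
    and wit: "similar_mat_wit M (theta_mat x d) P Q" and x: "x \<notin> bad_values d"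
    and rel: "\<And>v i. v \<in> carrier_vec (d+1) \<Longrightarrow> i < d+1 \<Longrightarrow>
      (M *\<^sub>v (M *\<^sub>v (N *\<^sub>v v))) $ i - 2 * (M *\<^sub>v (N *\<^sub>v (M *\<^sub>v v))) $ i
        + (N *\<^sub>v (M *\<^sub>v (M *\<^sub>v v))) $ i - 2 * ((M *\<^sub>v (N *\<^sub>v v)) $ i + (N *\<^sub>v (M *\<^sub>v v)) $ i)
      = 2 * (M *\<^sub>v (M *\<^sub>v v)) $ i + r * (M *\<^sub>v v) $ i + s * v $ i"
    and irr: "\<And>W. is_subspace (d+1) W \<Longrightarrow> invariant_under M W \<Longrightarrow> invariant_under N W
      \<Longrightarrow> W = {0\<^sub>v (d+1)} \<or> W = carrier_vec (d+1)"
  shows "irred_tridiagonal (Q * N * P)"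
proof -
  define n where "n = d + 1"
  define D where "D = theta_mat x d"
  note M = M[folded n_def] note N = N[folded n_def]
  have D: "D \<in> carrier_mat n n" "diagonal_mat D"
    unfolding D_def n_def by (rule theta_mat_carrier, rule diagonal_theta_mat)
  have Dii: "D $$ (i,i) = theta x d i" if "i < n" for i
    using that by (simp add: D_def theta_mat_def n_def)
  from similar_mat_witD2[OF M wit]
  have P: "P \<in> carrier_mat n n" and Q: "Q \<in> carrier_mat n n"
    and id: "P * Q = 1\<^sub>m n" "Q * P = 1\<^sub>m n" by auto
  have QMP: "Q * M * P = D"
    using similar_mat_witD(3)[OF refl similar_mat_wit_sym[OF wit]] by (simp add: D_def)
  have bc: "basis_change n P Q" using P Q id by (simp add: basis_change_def)
  define N' where "N' = Q * N * P"
  have N': "N' \<in> carrier_mat n n" using P Q N by (simp add: N'_def)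
  have PQv: "P *\<^sub>v (Q *\<^sub>v v) = v" if "v \<in> carrier_vec n" for v
    using that P Q id by (simp flip: assoc_mult_mat_vec)
  have QM: "(Q *\<^sub>v (M *\<^sub>v v)) $ i = theta x d i * (Q *\<^sub>v v) $ i"
    if v: "v \<in> carrier_vec n" and i: "i < n" for v i
  proof -
    have "D *\<^sub>v (Q *\<^sub>v v) = Q *\<^sub>v (M *\<^sub>v (P *\<^sub>v (Q *\<^sub>v v)))"
      unfolding QMP[symmetric] using v P Q M
      by (simp add: assoc_mult_mat_vec[where ?n\<^sub>1.0 = n and ?n\<^sub>2.0 = n and ?n\<^sub>3.0 = n])
    then have "Q *\<^sub>v (M *\<^sub>v v) = D *\<^sub>v (Q *\<^sub>v v)" using PQv[OF v] by simp
    then show ?thesis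
      using diagonal_mat_mult_vec_index[OF D _ i, of "Q *\<^sub>v v"] Q v Dii[OF i] by simp
  qed
  have off: "N' $$ (i,j) * ((theta x d i - theta x d j)^2 - 2 * (theta x d i + theta x d j)) = 0"
    if ij: "i < n" "j < n" "i \<noteq> j" for i j
  proof -
    define v where "v = P *\<^sub>v unit_vec n j"
    define u where "u = N *\<^sub>v v"
    define t where "t = theta x d j"
    have v: "v \<in> carrier_vec n" using P by (simp add: v_def)
    have u: "u \<in> carrier_vec n" using N v by (simp add: u_def)
    have Qv: "Q *\<^sub>v v = unit_vec n j"
      using P Q id by (simp add: v_def flip: assoc_mult_mat_vec)
    have Mv: "M *\<^sub>v v = t \<cdot>\<^sub>v v"
    proof -
      have "Q *\<^sub>v (M *\<^sub>v v) = t \<cdot>\<^sub>v unit_vec n j"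
      proof (rule eq_vecI)
        fix k assume "k < dim_vec (t \<cdot>\<^sub>v unit_vec n j)"
        then have "k < n" by simp
        then show "(Q *\<^sub>v (M *\<^sub>v v)) $ k = (t \<cdot>\<^sub>v unit_vec n j) $ k"
          using QM[OF v] ij by (auto simp: Qv t_def)
      qed (use Q in auto)
      then have "P *\<^sub>v (Q *\<^sub>v (M *\<^sub>v v)) = t \<cdot>\<^sub>v v"
        using P by (simp add: v_def mult_mat_vec[OF P])
      then show ?thesis using PQv[of "M *\<^sub>v v"] M v by simp
    qed
    \<comment> \<open>On an eigenvector \<open>v\<close> of M the relation becomes a quadratic in M
      applied to \<open>u = N v\<close>, with a multiple of \<open>v\<close> on the right.
      Coordinate i different from j of that multiple is zero, which gives the claim.\<close>
    have "M *\<^sub>v (M *\<^sub>v u) + (- 2 * t - 2) \<cdot>\<^sub>v (M *\<^sub>v u) + (t^2 - 2 * t) \<cdot>\<^sub>v u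
        = (2 * t^2 + r * t + s) \<cdot>\<^sub>v v"
    proof (rule eq_vecI)
      fix k assume "k < dim_vec ((2 * t^2 + r * t + s) \<cdot>\<^sub>v v)"
      then have k: "k < n" using v by simp
      note * = rel[folded n_def, OF v k]
      have Nt: "N *\<^sub>v (t \<cdot>\<^sub>v v) = t \<cdot>\<^sub>v u" "M *\<^sub>v (t \<cdot>\<^sub>v v) = t \<cdot>\<^sub>v (t \<cdot>\<^sub>v v)"
        "M *\<^sub>v (t \<cdot>\<^sub>v u) = t \<cdot>\<^sub>v (M *\<^sub>v u)" "N *\<^sub>v (t \<cdot>\<^sub>v (t \<cdot>\<^sub>v v)) = t \<cdot>\<^sub>v (t \<cdot>\<^sub>v u)"
        using v u by (simp_all add: mult_mat_vec[OF M] mult_mat_vec[OF N] Mv u_def)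
      define m1 where "m1 = M *\<^sub>v u"
      define m2 where "m2 = M *\<^sub>v m1"
      have m: "m1 \<in> carrier_vec n" "m2 \<in> carrier_vec n" using M u by (auto simp: m1_def m2_def)
      from * have "m2 $ k - 2 * (t * m1 $ k) + t * (t * u $ k) - 2 * (m1 $ k + t * u $ k)
          = 2 * (t * (t * v $ k)) + r * (t * v $ k) + s * v $ k"
        unfolding Mv Nt u_def[symmetric] m1_def[symmetric] m2_def[symmetric]
        using k m u v by simp
      then have "m2 $ k + (- 2 * t - 2) * m1 $ k + (t^2 - 2 * t) * u $ k
          = (2 * t^2 + r * t + s) * v $ k"
        by Groebner_Basis.algebra
      then show "(M *\<^sub>v (M *\<^sub>v u) + (- 2 * t - 2) \<cdot>\<^sub>v (M *\<^sub>v u) + (t^2 - 2 * t) \<cdot>\<^sub>v u) $ k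
          = ((2 * t^2 + r * t + s) \<cdot>\<^sub>v v) $ k"
        unfolding m1_def[symmetric] m2_def[symmetric] using k m u v by (simp add: add.assoc)
    qed (use M N u v in auto)
    then have "Q *\<^sub>v (M *\<^sub>v (M *\<^sub>v u) + (- 2 * t - 2) \<cdot>\<^sub>v (M *\<^sub>v u) + (t^2 - 2 * t) \<cdot>\<^sub>v u)
        = Q *\<^sub>v ((2 * t^2 + r * t + s) \<cdot>\<^sub>v v)" by simp
    moreover have "Q *\<^sub>v (M *\<^sub>v (M *\<^sub>v u) + (- 2 * t - 2) \<cdot>\<^sub>v (M *\<^sub>v u) + (t^2 - 2 * t) \<cdot>\<^sub>v u)
        = Q *\<^sub>v (M *\<^sub>v (M *\<^sub>v u)) + (- 2 * t - 2) \<cdot>\<^sub>v (Q *\<^sub>v (M *\<^sub>v u)) + (t^2 - 2 * t) \<cdot>\<^sub>v (Q *\<^sub>v u)"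
    proof -
      have c: "M *\<^sub>v u \<in> carrier_vec n" "M *\<^sub>v (M *\<^sub>v u) \<in> carrier_vec n" using M u by auto
      then have s: "(- 2 * t - 2) \<cdot>\<^sub>v (M *\<^sub>v u) \<in> carrier_vec n" "(t^2 - 2 * t) \<cdot>\<^sub>v u \<in> carrier_vec n"
        using u by auto
      show ?thesis
        unfolding mult_add_distrib_mat_vec[OF Q add_carrier_vec[OF c(2) s(1)] s(2)]
          mult_add_distrib_mat_vec[OF Q c(2) s(1)] mult_mat_vec[OF Q c(1)] mult_mat_vec[OF Q u] ..
    qed
    ultimately have eq: "Q *\<^sub>v (M *\<^sub>v (M *\<^sub>v u)) + (- 2 * t - 2) \<cdot>\<^sub>v (Q *\<^sub>v (M *\<^sub>v u))
        + (t^2 - 2 * t) \<cdot>\<^sub>v (Q *\<^sub>v u) = (2 * t^2 + r * t + s) \<cdot>\<^sub>v unit_vec n j"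
      using v by (simp add: mult_mat_vec[OF Q] Qv)
    define q0 where "q0 = Q *\<^sub>v u"
    define q1 where "q1 = Q *\<^sub>v (M *\<^sub>v u)"
    define q2 where "q2 = Q *\<^sub>v (M *\<^sub>v (M *\<^sub>v u))"
    have q: "q0 \<in> carrier_vec n" "q1 \<in> carrier_vec n" "q2 \<in> carrier_vec n"
      unfolding q0_def q1_def q2_def using Q M u by (auto intro!: mult_mat_vec_carrier)
    have "q2 $ i + (- 2 * t - 2) * q1 $ i + (t^2 - 2 * t) * q0 $ i = 0"
      using arg_cong[OF eq, of "\<lambda>v. v $ i"] ij q
      unfolding q0_def[symmetric] q1_def[symmetric] q2_def[symmetric] by (simp add: add.assoc)
    moreover have "q1 $ i = theta x d i * q0 $ i"
      unfolding q0_def q1_def by (rule QM[OF u ij(1)])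
    moreover have "q2 $ i = theta x d i * q1 $ i"
      unfolding q2_def q1_def using M u by (intro QM ij) auto
    moreover have "q0 = N' *\<^sub>v unit_vec n j"
      unfolding q0_def u_def v_def N'_def using P Q N
      by (simp add: assoc_mult_mat_vec[where ?n\<^sub>1.0 = n and ?n\<^sub>2.0 = n and ?n\<^sub>3.0 = n])
    then have "q0 $ i = N' $$ (i,j)"
      using N' ij by (simp add: mult_mat_unit_vec[OF N'])
    ultimately show ?thesis unfolding t_def by Groebner_Basis.algebra
  qed
  have tri: "i \<le> j + 1 \<and> j \<le> i + 1" if "i < n" "j < n" "N' $$ (i,j) \<noteq> 0" for i j
  proof (cases "i = j")
    case False
    from off[OF that(1,2) False] that(3)
    have "(theta x d i - theta x d j)^2 = 2 * (theta x d i + theta x d j)" by simp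
    from theta_adjacent[OF x _ _ this] that show ?thesis by (simp add: n_def)
  qed simp
  have block: False
    if S: "S \<subseteq> {..<n}" "S \<noteq> {}" "S \<noteq> {..<n}"
      and 0: "\<And>k l. k \<in> S \<Longrightarrow> l < n \<Longrightarrow> l \<notin> S \<Longrightarrow> N' $$ (k,l) = 0" for S
  proof -
    have "(Q * M * P) $$ (k,l) = 0" if "k \<in> S" "l < n" "l \<notin> S" for k l
      using D S(1) that unfolding QMP diagonal_mat_def by auto
    from invariant_coordinate_subspace[OF M N bc S this 0[unfolded N'_def]] irr
    show False unfolding n_def by blast
  qed
  have sub: "N' $$ (i+1, i) \<noteq> 0" if "i + 1 < n" for i
  proof
    assume 0: "N' $$ (i+1, i) = 0"
    show False
    \<comment> \<open>In the block of rows beyond i and columns up to i, tridiagonality leaves only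
      the entry (i+1, i).\<close>
    proof (rule block[of "{i<..<n}"])
      fix k l assume kl: "k \<in> {i<..<n}" "l < n" "l \<notin> {i<..<n}"
      show "N' $$ (k,l) = 0"
      proof (rule ccontr)
        assume nz: "N' $$ (k,l) \<noteq> 0"
        have "k < n" using kl(1) by simp
        from tri[OF this kl(2) nz] kl have "k = i + 1" "l = i" by simp_all
        with nz 0 show False by simp
      qed
    next
      have "i + 1 \<in> {i<..<n}" "i \<in> {..<n}" "i \<notin> {i<..<n}" using that by simp_all
      then show "{i<..<n} \<noteq> {}" "{i<..<n} \<noteq> {..<n}" by blast+
    qed auto
  qed
  have super: "N' $$ (i, i+1) \<noteq> 0" if "i + 1 < n" for i
  proof
    assume 0: "N' $$ (i, i+1) = 0"
    show False
    \<comment> \<open>The opposite block: rows up to i and columns beyond i leave only (i,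
      i+1).\<close>
    proof (rule block[of "{..i}"])
      fix k l assume kl: "k \<in> {..i}" "l < n" "l \<notin> {..i}"
      show "N' $$ (k,l) = 0"
      proof (rule ccontr)
        assume nz: "N' $$ (k,l) \<noteq> 0"
        have "k < n" using kl(1) that by simp
        from tri[OF this kl(2) nz] kl have "k = i" "l = i + 1" by simp_all
        with nz 0 show False by simp
      qed
    next
      have "i + 1 \<in> {..<n}" "i + 1 \<notin> {..i}" using that by simp_all
      then show "{..i} \<noteq> {..<n}" by blast
      show "{..i} \<subseteq> {..<n}" using that by auto
    qed simp
  qed
  show ?thesis
    unfolding N'_def[symmetric] irred_tridiagonal_def tridiagonal_def
    using tri sub super N' by auto
qed

text \<open>Where M is diagonal, K and N differ off the diagonal only by sign, so the third operator
  of the triple inherits its shape from the second.\<close>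

lemma irred_tridiagonal_complement:
  fixes M N K :: "complex mat"
  assumes car: "M \<in> carrier_mat n n" "N \<in> carrier_mat n n" "P \<in> carrier_mat n n" "Q \<in> carrier_mat n n"
    and id: "Q * P = 1\<^sub>m n"
    and K: "K = s \<cdot>\<^sub>m 1\<^sub>m n - M - N"
    and diag: "diagonal_mat (Q * M * P)" and tri: "irred_tridiagonal (Q * N * P)"
  shows "irred_tridiagonal (Q * K * P)"
proof -
  have conj: "Q * (X - Y) * P = Q * X * P - Q * Y * P"
    if "X \<in> carrier_mat n n" "Y \<in> carrier_mat n n" for X Y
    using mult_minus_distrib_mat[OF car(4) that]
      minus_mult_distrib_mat[OF mult_carrier_mat[OF car(4) that(1)] mult_carrier_mat[OF car(4) that(2)] car(3)]
    by simp
  have one: "s \<cdot>\<^sub>m 1\<^sub>m n \<in> carrier_mat n n" "s \<cdot>\<^sub>m 1\<^sub>m n - M \<in> carrier_mat n n"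
    using car by auto
  have "Q * K * P = Q * (s \<cdot>\<^sub>m 1\<^sub>m n) * P - Q * M * P - Q * N * P"
    unfolding K conj[OF one(2) car(2)] conj[OF one(1) car(1)] ..
  also have "Q * (s \<cdot>\<^sub>m 1\<^sub>m n) * P = s \<cdot>\<^sub>m 1\<^sub>m n"
    using car id by (simp add: mult_smult_distrib[where nr = n and n = n and nc = n]
        mult_smult_assoc_mat[where nr = n and n = n and nc = n])
  finally have "Q * K * P = s \<cdot>\<^sub>m 1\<^sub>m n - Q * M * P - Q * N * P" .
  then have off: "(Q * K * P) $$ (i,j) = - (Q * N * P) $$ (i,j)" if "i < n" "j < n" "i \<noteq> j" for i j
    using that car diag by (simp add: diagonal_mat_def)
  have dims: "dim_row (Q * K * P) = n" "dim_col (Q * K * P) = n"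
    "dim_row (Q * N * P) = n" "dim_col (Q * N * P) = n" using car by auto
  show ?thesis
    unfolding irred_tridiagonal_def tridiagonal_def dims
  proof (intro conjI allI impI)
    fix i j assume ij: "i < n" "j < n" and nz: "(Q * K * P) $$ (i,j) \<noteq> 0"
    have "i \<le> j + 1 \<and> j \<le> i + 1"
    proof (cases "i = j")
      case False
      with off[OF ij] nz tri ij show ?thesis
        unfolding irred_tridiagonal_def tridiagonal_def dims by auto
    qed simp
    then show "i \<le> j + 1" "j \<le> i + 1" by auto
  next
    fix i assume i: "i + 1 < n"
    with tri have "(Q * N * P) $$ (i+1, i) \<noteq> 0" "(Q * N * P) $$ (i, i+1) \<noteq> 0"
      unfolding irred_tridiagonal_def dims by auto
    then show "(Q * K * P) $$ (i+1, i) \<noteq> 0" "(Q * K * P) $$ (i, i+1) \<noteq> 0"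
      using off[of "i+1" i] off[of i "i+1"] i by auto
  qed
qed

text \<open>One clause of the Leonard triple from one relation. It is applied to (M,N,K) = (A,B,C),
  (B,A,C) and (C,A,B).\<close>

lemma eigenbasis_diagonal_tridiagonal:
  fixes M N K :: "complex mat"
  assumes M: "M \<in> carrier_mat (d+1) (d+1)" and N: "N \<in> carrier_mat (d+1) (d+1)"
    and sim: "similar_mat M (RA x b c d)" and x: "x \<notin> bad_values d"
    and F: "\<And>f. M *\<^sub>v vec (d+1) f = vec (d+1) (F f)"
    and G: "\<And>f. N *\<^sub>v vec (d+1) f = vec (d+1) (G f)"
    and rel: "\<And>f i. F (F (G f)) i - 2 * F (G (F f)) i + G (F (F f)) i - 2 * (F (G f) i + G (F f) i)
      = 2 * F (F f) i - 2 * r * F f i + 2 * s * f i"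
    and irr: "\<And>W. is_subspace (d+1) W \<Longrightarrow> invariant_under M W \<Longrightarrow> invariant_under N W
      \<Longrightarrow> W = {0\<^sub>v (d+1)} \<or> W = carrier_vec (d+1)"
    and K: "K = \<delta> \<cdot>\<^sub>m 1\<^sub>m (d+1) - M - N"
  shows "\<exists>P Q. basis_change (d+1) P Q \<and> diagonal_mat (Q * M * P)
    \<and> irred_tridiagonal (Q * N * P) \<and> irred_tridiagonal (Q * K * P)"
proof -
  have "similar_mat M (theta_mat x d)"
    using sim RA_similar_theta_mat[OF x] by (rule similar_mat_trans)
  then obtain P Q where wit: "similar_mat_wit M (theta_mat x d) P Q"
    unfolding similar_mat_def by auto
  from similar_mat_witD2[OF M wit]
  have PQ: "P \<in> carrier_mat (d+1) (d+1)" "Q \<in> carrier_mat (d+1) (d+1)"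
    "P * Q = 1\<^sub>m (d+1)" "Q * P = 1\<^sub>m (d+1)" by auto
  have diag: "diagonal_mat (Q * M * P)"
    using similar_mat_witD(3)[OF refl similar_mat_wit_sym[OF wit]] diagonal_theta_mat by metis
  have tri: "irred_tridiagonal (Q * N * P)"
  proof (rule eigenbasis_irred_tridiagonal[OF M N wit x _ irr, where r = "- 2 * r" and s = "2 * s"])
    fix v :: "complex vec" and i assume v: "v \<in> carrier_vec (d+1)" and i: "i < d + 1"
    \<comment> \<open>Every vector is the truncation of its index function, so the relation passes
      from sequences to matrices.\<close>
    define f where "f = vec_index v"
    have "v = vec (d+1) f" using v by (auto simp: f_def)
    then show "(M *\<^sub>v (M *\<^sub>v (N *\<^sub>v v))) $ i - 2 * (M *\<^sub>v (N *\<^sub>v (M *\<^sub>v v))) $ i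
        + (N *\<^sub>v (M *\<^sub>v (M *\<^sub>v v))) $ i - 2 * ((M *\<^sub>v (N *\<^sub>v v)) $ i + (N *\<^sub>v (M *\<^sub>v v)) $ i)
      = 2 * (M *\<^sub>v (M *\<^sub>v v)) $ i + - 2 * r * (M *\<^sub>v v) $ i + 2 * s * v $ i"
      using rel[of f i] i by (simp only: F G index_vec) simp
  qed
  have "irred_tridiagonal (Q * K * P)"
    by (rule irred_tridiagonal_complement[OF M N PQ(1,2,4) K diag tri])
  with PQ diag tri show ?thesis unfolding basis_change_def by blast
qed

section \<open>Consequences of irreducibility and the equivalence\<close>

lemma smult_mat_mult_vec:
  fixes A :: "complex mat"
  assumes "A \<in> carrier_mat n m" "v \<in> carrier_vec m"
  shows "(s \<cdot>\<^sub>m A) *\<^sub>v v = s \<cdot>\<^sub>v (A *\<^sub>v v)"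
  using assms
  by (intro eq_vecI) (auto simp: scalar_prod_def sum_distrib_left mult.assoc intro!: sum.cong)

text \<open>C and Delta have these two forms in A and B, so irreducibility can be tested on A and B
  alone. The first form also recovers B from C and A.\<close>

lemma invariant_under_combination:
  assumes W: "is_subspace (d+1) W" and M: "M \<in> carrier_mat (d+1) (d+1)" and N: "N \<in> carrier_mat (d+1) (d+1)"
    and inv: "invariant_under M W" "invariant_under N W"
  shows "invariant_under (s \<cdot>\<^sub>m 1\<^sub>m (d+1) - M - N) W"
    and "invariant_under (s \<cdot>\<^sub>m (M * N - N * M)) W"
proof -
  have Wc: "W \<subseteq> carrier_vec (d+1)" and add: "\<And>u v. u \<in> W \<Longrightarrow> v \<in> W \<Longrightarrow> u + v \<in> W"
    and smult: "\<And>k u. u \<in> W \<Longrightarrow> k \<cdot>\<^sub>v u \<in> W"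
    using W by (auto simp: is_subspace_def)
  have diff: "u - v \<in> W" if "u \<in> W" "v \<in> W" for u v
  proof -
    have "u - v = u + (-1) \<cdot>\<^sub>v v" using that Wc by (intro eq_vecI) auto
    then show ?thesis using that add smult by simp
  qed
  show "invariant_under (s \<cdot>\<^sub>m 1\<^sub>m (d+1) - M - N) W"
    unfolding invariant_under_def
  proof
    fix v assume v: "v \<in> W"
    then have vc: "v \<in> carrier_vec (d+1)" using Wc by auto
    have "(s \<cdot>\<^sub>m 1\<^sub>m (d+1) - M - N) *\<^sub>v v = s \<cdot>\<^sub>v v - M *\<^sub>v v - N *\<^sub>v v"
    proof -
      have c: "s \<cdot>\<^sub>m 1\<^sub>m (d+1) \<in> carrier_mat (d+1) (d+1)"
        "s \<cdot>\<^sub>m 1\<^sub>m (d+1) - M \<in> carrier_mat (d+1) (d+1)" using M by auto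
      have "(s \<cdot>\<^sub>m 1\<^sub>m (d+1)) *\<^sub>v v = s \<cdot>\<^sub>v v" using vc by auto
      then show ?thesis
        using minus_mult_distrib_mat_vec[OF c(2) N vc] minus_mult_distrib_mat_vec[OF c(1) M vc] by simp
    qed
    then show "(s \<cdot>\<^sub>m 1\<^sub>m (d+1) - M - N) *\<^sub>v v \<in> W"
      using v inv diff smult by (simp add: invariant_under_def)
  qed
  show "invariant_under (s \<cdot>\<^sub>m (M * N - N * M)) W"
    unfolding invariant_under_def
  proof
    fix v assume v: "v \<in> W"
    then have vc: "v \<in> carrier_vec (d+1)" using Wc by auto
    have c: "M * N \<in> carrier_mat (d+1) (d+1)" "N * M \<in> carrier_mat (d+1) (d+1)"
      "M * N - N * M \<in> carrier_mat (d+1) (d+1)" using M N by auto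
    have "(s \<cdot>\<^sub>m (M * N - N * M)) *\<^sub>v v = s \<cdot>\<^sub>v ((M * N - N * M) *\<^sub>v v)"
      by (rule smult_mat_mult_vec[OF c(3) vc])
    also have "\<dots> = s \<cdot>\<^sub>v (M *\<^sub>v (N *\<^sub>v v) - N *\<^sub>v (M *\<^sub>v v))"
      using minus_mult_distrib_mat_vec[OF c(1,2) vc] assoc_mult_mat_vec[OF M N vc]
        assoc_mult_mat_vec[OF N M vc] by simp
    finally show "(s \<cdot>\<^sub>m (M * N - N * M)) *\<^sub>v v \<in> W"
      using v inv diff smult by (simp add: invariant_under_def)
  qed
qed

lemma R_irreducible_RA_RB:
  assumes "R_irreducible a b c d" "is_subspace (d+1) W"
    "invariant_under (RA a b c d) W" "invariant_under (RB a b c d) W"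
  shows "W = {0\<^sub>v (d+1)} \<or> W = carrier_vec (d+1)"
  using assms invariant_under_combination[OF assms(2) R_carrier(1,2) assms(3,4)]
  unfolding R_irreducible_def RC_def RDelta_def by blast

lemma RB_eq: "RB a b c d = deltaR a b c d \<cdot>\<^sub>m 1\<^sub>m (d+1) - RC a b c d - RA a b c d"
  by (rule eq_matI) (auto simp: RC_def)

lemma RC_eq: "RC a b c d = deltaR a b c d \<cdot>\<^sub>m 1\<^sub>m (d+1) - RB a b c d - RA a b c d"
  by (rule eq_matI) (auto simp: RC_def)

text \<open>The span of e_i, ..., e_d is stable under the lower triangular A, and the only entry of
  B leading out of it is phi_i.\<close>

lemma R_irreducible_phi_nonzero:
  assumes irr: "R_irreducible a b c d" and i: "1 \<le> i" "i \<le> d"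
  shows "phi a b c d i \<noteq> 0"
proof
  assume 0: "phi a b c d i = 0"
  have bc: "basis_change (d+1) (1\<^sub>m (d+1)) (1\<^sub>m (d+1))" by (simp add: basis_change_def)
  have "\<exists>W. is_subspace (d+1) W \<and> invariant_under (RA a b c d) W \<and> invariant_under (RB a b c d) W
    \<and> W \<noteq> {0\<^sub>v (d+1)} \<and> W \<noteq> carrier_vec (d+1)"
  proof (rule invariant_coordinate_subspace[OF R_carrier(1,2) bc, where S = "{..<i}"])
    fix k l assume kl: "k \<in> {..<i}" "l < d + 1" "l \<notin> {..<i}"
    show "(1\<^sub>m (d+1) * RA a b c d * 1\<^sub>m (d+1)) $$ (k,l) = 0"
      using kl by (simp add: RA_def)
    have "phi a b c d l = 0" if "l = k + 1"
    proof -
      have "l = i" using that kl by auto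
      with 0 show ?thesis by simp
    qed
    then show "(1\<^sub>m (d+1) * RB a b c d * 1\<^sub>m (d+1)) $$ (k,l) = 0"
      using kl by (auto simp: RB_def)
  qed (use i in \<open>auto simp: lessThan_empty_iff\<close>)
  with R_irreducible_RA_RB[OF irr] show False by blast
qed

theorem theorem6p9:
  fixes a b c :: complex and d :: nat
  assumes "R_irreducible a b c d"
  shows "(leonard_triple (d+1) (RA a b c d) (RB a b c d) (RC a b c d)
            \<longleftrightarrow> diagonalizable (d+1) (RA a b c d) \<and> diagonalizable (d+1) (RB a b c d)
                \<and> diagonalizable (d+1) (RC a b c d))
       \<and> (diagonalizable (d+1) (RA a b c d) \<and> diagonalizable (d+1) (RB a b c d)
                \<and> diagonalizable (d+1) (RC a b c d)
            \<longleftrightarrow> a \<notin> bad_values d \<and> b \<notin> bad_values d \<and> c \<notin> bad_values d)"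
proof -
  note irr = R_irreducible_RA_RB[OF assms]
  have simA: "similar_mat (RA a b c d) (RA a b c d)"
    by (rule similar_mat_refl[OF R_carrier(1)])
  have simB: "similar_mat (RB a b c d) (RA (- b - 1) b c d)"
    by (rule RB_similar_RA[OF R_irreducible_phi_nonzero[OF assms]])
  have simC: "similar_mat (RC a b c d) (RA c b c d)" by (rule RC_similar_RA)
  have diag: "diagonalizable (d+1) (RA a b c d) \<longleftrightarrow> a \<notin> bad_values d"
    "diagonalizable (d+1) (RB a b c d) \<longleftrightarrow> b \<notin> bad_values d"
    "diagonalizable (d+1) (RC a b c d) \<longleftrightarrow> c \<notin> bad_values d"
    using diagonalizable_iff_of_similar_RA[OF R_carrier(1) simA]
      diagonalizable_iff_of_similar_RA[OF R_carrier(2) simB]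
      diagonalizable_iff_of_similar_RA[OF R_carrier(3) simC]
    by (simp_all add: bad_values_reflect)
  have triple: "leonard_triple (d+1) (RA a b c d) (RB a b c d) (RC a b c d)"
    if good: "a \<notin> bad_values d" "b \<notin> bad_values d" "c \<notin> bad_values d"
  proof -
    have irrBA: "W = {0\<^sub>v (d+1)} \<or> W = carrier_vec (d+1)"
      if "is_subspace (d+1) W" "invariant_under (RB a b c d) W" "invariant_under (RA a b c d) W" for W
      using irr that by blast
    have irrCA: "W = {0\<^sub>v (d+1)} \<or> W = carrier_vec (d+1)"
      if "is_subspace (d+1) W" "invariant_under (RC a b c d) W" "invariant_under (RA a b c d) W" for W
      \<comment> \<open>Invariance under C and A gives invariance under B = delta - C - A, which
        reduces to the pair (A,B).\<close>
      using invariant_under_combination(1)[OF that(1) R_carrier(3,1) that(2,3), of "deltaR a b c d"]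
        irr[OF that(1,3)]
      unfolding RB_eq[symmetric] by blast
    have good_b: "- b - 1 \<notin> bad_values d" using good by (simp add: bad_values_reflect)
    note A = eigenbasis_diagonal_tridiagonal[OF R_carrier(1,2) simA good(1) RA_mult_vec RB_mult_vec
        seqA_seqB_relation irr RC_def]
    \<comment> \<open>The eigenvalues of B are listed in reversed order, hence the parameter -b-1,
      which is good exactly when b is.\<close>
    note B = eigenbasis_diagonal_tridiagonal[OF R_carrier(2,1) simB good_b RB_mult_vec RA_mult_vec
        seqB_seqA_relation irrBA RC_eq]
    note C = eigenbasis_diagonal_tridiagonal[OF R_carrier(3,1) simC good(3) RC_mult_vec RA_mult_vec
        seqC_seqA_relation irrCA RB_eq]
    show ?thesis unfolding leonard_triple_def using A B C by simp
  qed
  have "leonard_triple (d+1) (RA a b c d) (RB a b c d) (RC a b c d) \<Longrightarrow>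
      diagonalizable (d+1) (RA a b c d) \<and> diagonalizable (d+1) (RB a b c d)
      \<and> diagonalizable (d+1) (RC a b c d)"
    unfolding leonard_triple_def diagonalizable_def by blast
  with diag triple show ?thesis by blast
qed

end
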